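(* Let $d\ge1$ and let $\mathsf{dist}$ be a generalized distance on $\mathcal P(\mathbb Z_+^d)$ satisfying the decomposition property and the sandwich property. Let $\boldsymbol Y_1,\dots,\boldsymbol Y_n$ be i.i.d. from $f_G$, let $p_n^{\mathsf{emp}}=\frac1n\sum_{i=1}^n\delta_{\boldsymbol Y_i}$, and let $\hat G\in\operatorname{argmin}_{Q\in\mathcal P(\mathbb R_+^d)}\mathsf{dist}(p_n^{\mathsf{emp}}\,\|\,f_Q)$ be the unconstrained minimum-distance estimator. Then there exist constants $c_1,c_2$ such that, for $n\ge3$, the following hold. (i) For all $h>0$, $\displaystyle\sup_{G\in\mathcal P([0,h]^d)}\mathbb E\left[H^2(f_{\hat G},f_G)\right]\le\frac{(c_1K)^d}{n}$, where $K=\min\left\{\max\{1,h\}\frac{\log n}{\log\log n},\ h+\log n\right\}$. (ii) If the data-generating prior $G$ belongs to a class $\mathcal G\subset\mathcal P(\mathbb R_+^d)$ such that all (one-dimensional) marginals of every $G\in\mathcal G$ belong to $\mathsf{SubE}(s)$ for some $s>0$, then $\displaystyle\sup_{G\in\mathcal G}\mathbb E\left[H^2(f_{\hat G},f_G)\right]\le\frac{(c_2\max\{1,s\})^d}{n}(\log n)^d$.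
   Context: $\mathbb Z_+=\{0,1,2,\dots\}$, $\mathbb R_+=[0,\infty)$; $\mathcal P(\Theta)$ is the set of Borel probability measures on $\Theta$, and $\mathcal P(\mathbb Z_+^d)$ the set of probability mass functions on $\mathbb Z_+^d$. $\mathsf{SubE}(s)=\{G\in\mathcal P(\mathbb R_+):G([t,\infty))\le 2e^{-t/s}\ \forall t>0\}$. For $G\in\mathcal P(\mathbb R_+^d)$, the $d$-dimensional Poisson mixture is $f_G(\boldsymbol y)=\int\prod_{j=1}^d e^{-\theta_j}\frac{\theta_j^{y_j}}{y_j!}\,dG(\boldsymbol\theta)$, $\boldsymbol y\in\mathbb Z_+^d$ (with $0^0=1$). $H^2(p,q)=\sum_{\boldsymbol y}(\sqrt{p(\boldsymbol y)}-\sqrt{q(\boldsymbol y)})^2$; $\chi^2(p\|q)=\sum_{\boldsymbol y}\frac{(p(\boldsymbol y)-q(\boldsymbol y))^2}{q(\boldsymbol y)}$, sums over $\mathbb Z_+^d$. A generalized distance is a map $\mathsf{dist}:\mathcal P(\mathbb Z_+^d)\times\mathcal P(\mathbb Z_+^d)\to[0,\infty]$ with $\mathsf{dist}(p\|q)\ge 0$ and equality if and only if $p=q$. Decomposition property: there exist maps $t:\mathcal P(\mathbb Z_+^d)\to\mathbb R$ and $\ell:[0,\infty)^2\to(-\infty,\infty]$, with $\ell(a,b)$ finite for $b>0$, such that for all $q_1,q_2\in\mathcal P(\mathbb Z_+^d)$, $\mathsf{dist}(q_1\|q_2)=t(q_1)+\sum_{\boldsymbol y\in\mathbb Z_+^d}\ell(q_1(\boldsymbol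 y),q_2(\boldsymbol y))$, where $b\mapsto\ell(a,b)$ is strictly decreasing and strictly convex (and continuous on $[0,\infty)$ as an extended-real-valued function) for each $a>0$, and $\ell(0,b)=0$ for all $b\ge0$. Sandwich property: there exist absolute constants $\kappa_1,\kappa_2>0$ such that $\kappa_1H^2(q_1,q_2)\le\mathsf{dist}(q_1\|q_2)\le\kappa_2\chi^2(q_1\|q_2)$ for all $q_1,q_2\in\mathcal P(\mathbb Z_+^d)$. The constants $c_1,c_2$ in the claim may depend on $\kappa_1,\kappa_2$ but not on $h,s,d,n$. *)

theory Defs
  imports "HOL-Probability.Probability"
begin

text \<open>
  The dimension \<open>d\<close> is an ordinary natural number, so that constants can be chosen uniformly in it.
  Vectors of length \<open>d\<close> are extensional functions on \<open>{..<d}\<close>, in accordance with the product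
  measure \<open>\<Pi>\<^sub>M j\<in>{..<d}. borel\<close>, which is the Borel sigma-algebra of the \<open>d\<close>-dimensional space.
\<close>

definition nat_vecs :: "nat \<Rightarrow> (nat \<Rightarrow> nat) set" where
  "nat_vecs d = ({..<d} \<rightarrow>\<^sub>E UNIV)"

definition nonneg_vecs :: "nat \<Rightarrow> (nat \<Rightarrow> real) set" where
  "nonneg_vecs d = ({..<d} \<rightarrow>\<^sub>E {0..})"

definition cube :: "nat \<Rightarrow> real \<Rightarrow> (nat \<Rightarrow> real) set" where
  "cube d h = ({..<d} \<rightarrow>\<^sub>E {0..h})"

definition borel_probs :: "nat \<Rightarrow> (nat \<Rightarrow> real) set \<Rightarrow> (nat \<Rightarrow> real) measure set" where
  "borel_probs d \<Theta> =
     {G. prob_space G \<and> sets G = sets (restrict_space (\<Pi>\<^sub>M j\<in>{..<d}. borel) \<Theta>)}"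

definition pmfs :: "nat \<Rightarrow> (nat \<Rightarrow> nat) pmf set" where
  "pmfs d = {q. set_pmf q \<subseteq> nat_vecs d}"

definition SubE :: "real \<Rightarrow> real measure set" where
  "SubE s = {G. prob_space G \<and> sets G = sets (restrict_space borel {0..}) \<and>
                (\<forall>t>0. measure G {t..} \<le> 2 * exp (- t / s))}"

definition marginal :: "nat \<Rightarrow> (nat \<Rightarrow> real) measure \<Rightarrow> real measure" where
  "marginal j G = distr G (restrict_space borel {0..}) (\<lambda>\<theta>. \<theta> j)"

definition poisson_mass :: "nat \<Rightarrow> (nat \<Rightarrow> real) \<Rightarrow> (nat \<Rightarrow> nat) \<Rightarrow> real" where
  "poisson_mass d \<theta> y = (\<Prod>j<d. exp (- \<theta> j) * \<theta> j ^ y j / fact (y j))"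

text \<open>
  \<^term>\<open>embed_pmf\<close> is meaningful only for functions that are probability mass functions; that this
  is the case here is the content of \<open>pmf_poisson_mixture\<close> below.
\<close>

definition poisson_mixture :: "nat \<Rightarrow> (nat \<Rightarrow> real) measure \<Rightarrow> (nat \<Rightarrow> nat) pmf" where
  "poisson_mixture d G =
     embed_pmf (\<lambda>y. if y \<in> nat_vecs d then (\<integral>\<theta>. poisson_mass d \<theta> y \<partial>G) else 0)"

definition hellinger_sq :: "nat \<Rightarrow> (nat \<Rightarrow> nat) pmf \<Rightarrow> (nat \<Rightarrow> nat) pmf \<Rightarrow> ennreal" where
  "hellinger_sq d p q = (\<Sum>\<^sub>\<infinity>y\<in>nat_vecs d. ennreal ((sqrt (pmf p y) - sqrt (pmf q y))\<^sup>2))"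

text \<open>
  Division in \<^typ>\<open>ennreal\<close> yields the usual conventions \<open>0 / 0 = 0\<close> and \<open>a / 0 = \<infinity>\<close> for \<open>a > 0\<close>.
\<close>

definition chi_sq :: "nat \<Rightarrow> (nat \<Rightarrow> nat) pmf \<Rightarrow> (nat \<Rightarrow> nat) pmf \<Rightarrow> ennreal" where
  "chi_sq d p q = (\<Sum>\<^sub>\<infinity>y\<in>nat_vecs d. ennreal ((pmf p y - pmf q y)\<^sup>2) / ennreal (pmf q y))"

text \<open>Only the values of \<open>D\<close> on \<^term>\<open>pmfs d\<close> matter.\<close>

definition generalized_distance ::
    "nat \<Rightarrow> ((nat \<Rightarrow> nat) pmf \<Rightarrow> (nat \<Rightarrow> nat) pmf \<Rightarrow> ennreal) \<Rightarrow> bool" where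
  "generalized_distance d D \<longleftrightarrow> (\<forall>p\<in>pmfs d. \<forall>q\<in>pmfs d. D p q = 0 \<longleftrightarrow> p = q)"

definition strictly_convex_on :: "real set \<Rightarrow> (real \<Rightarrow> ereal) \<Rightarrow> bool" where
  "strictly_convex_on S f \<longleftrightarrow>
     (\<forall>x\<in>S. \<forall>y\<in>S. \<forall>u. x \<noteq> y \<and> 0 < u \<and> u < 1 \<longrightarrow>
        f ((1 - u) * x + u * y) < ereal (1 - u) * f x + ereal u * f y)"

text \<open>
  The terms \<open>l (q\<^sub>1 y) (q\<^sub>2 y)\<close> may have both signs and may be \<open>\<infinity>\<close>; their sum is required to exist
  as an unconditional sum in \<^typ>\<open>ereal\<close>.
\<close>

definition decomposition_property ::
    "nat \<Rightarrow> ((nat \<Rightarrow> nat) pmf \<Rightarrow> (nat \<Rightarrow> nat) pmf \<Rightarrow> ennreal) \<Rightarrow> bool" where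
  "decomposition_property d D \<longleftrightarrow>
     (\<exists>(t :: (nat \<Rightarrow> nat) pmf \<Rightarrow> real) (l :: real \<Rightarrow> real \<Rightarrow> ereal).
        (\<forall>a\<ge>0. \<forall>b\<ge>0. l a b \<noteq> -\<infinity>) \<and>
        (\<forall>a\<ge>0. \<forall>b>0. \<bar>l a b\<bar> \<noteq> \<infinity>) \<and>
        (\<forall>q\<^sub>1\<in>pmfs d. \<forall>q\<^sub>2\<in>pmfs d. \<exists>S.
           ((\<lambda>y. l (pmf q\<^sub>1 y) (pmf q\<^sub>2 y)) has_sum S) (nat_vecs d) \<and>
           enn2ereal (D q\<^sub>1 q\<^sub>2) = ereal (t q\<^sub>1) + S) \<and>
        (\<forall>a>0. strict_antimono_on {0..} (l a) \<and> strictly_convex_on {0..} (l a) \<and>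
               continuous_on {0..} (l a)) \<and>
        (\<forall>b\<ge>0. l 0 b = 0))"

definition sandwich_property ::
    "real \<Rightarrow> real \<Rightarrow> nat \<Rightarrow> ((nat \<Rightarrow> nat) pmf \<Rightarrow> (nat \<Rightarrow> nat) pmf \<Rightarrow> ennreal) \<Rightarrow> bool" where
  "sandwich_property \<kappa>\<^sub>1 \<kappa>\<^sub>2 d D \<longleftrightarrow>
     (\<forall>q\<^sub>1\<in>pmfs d. \<forall>q\<^sub>2\<in>pmfs d.
        ennreal \<kappa>\<^sub>1 * hellinger_sq d q\<^sub>1 q\<^sub>2 \<le> D q\<^sub>1 q\<^sub>2 \<and>
        D q\<^sub>1 q\<^sub>2 \<le> ennreal \<kappa>\<^sub>2 * chi_sq d q\<^sub>1 q\<^sub>2)"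

text \<open>A sample of size \<open>n\<close> is a function on \<open>{..<n}\<close>; its empirical distribution is
  \<open>(1/n) \<Sum>i<n. \<delta>(Y i)\<close>.\<close>

definition empirical :: "nat \<Rightarrow> (nat \<Rightarrow> nat \<Rightarrow> nat) \<Rightarrow> (nat \<Rightarrow> nat) pmf" where
  "empirical n Y = map_pmf Y (pmf_of_set {..<n})"

definition iid_sample :: "nat \<Rightarrow> (nat \<Rightarrow> nat) pmf \<Rightarrow> (nat \<Rightarrow> nat \<Rightarrow> nat) pmf" where
  "iid_sample n p = Pi_pmf {..<n} undefined (\<lambda>_. p)"

definition min_distance_estimator ::
    "nat \<Rightarrow> nat \<Rightarrow> ((nat \<Rightarrow> nat) pmf \<Rightarrow> (nat \<Rightarrow> nat) pmf \<Rightarrow> ennreal) \<Rightarrow>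
     ((nat \<Rightarrow> nat \<Rightarrow> nat) \<Rightarrow> (nat \<Rightarrow> real) measure) \<Rightarrow> bool" where
  "min_distance_estimator d n D Ghat \<longleftrightarrow>
     (\<forall>Y \<in> {..<n} \<rightarrow>\<^sub>E nat_vecs d.
        is_arg_min (\<lambda>Q. D (empirical n Y) (poisson_mixture d Q))
                   (\<lambda>Q. Q \<in> borel_probs d (nonneg_vecs d)) (Ghat Y))"

definition hellinger_risk ::
    "nat \<Rightarrow> nat \<Rightarrow> ((nat \<Rightarrow> nat \<Rightarrow> nat) \<Rightarrow> (nat \<Rightarrow> real) measure) \<Rightarrow>
     (nat \<Rightarrow> real) measure \<Rightarrow> ennreal" where
  "hellinger_risk d n Ghat G =
     (\<integral>\<^sup>+Y. hellinger_sq d (poisson_mixture d (Ghat Y)) (poisson_mixture d G)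
        \<partial>measure_pmf (iid_sample n (poisson_mixture d G)))"

lemma poisson_mass_nonneg: "\<theta> \<in> nonneg_vecs d \<Longrightarrow> 0 \<le> poisson_mass d \<theta> y"
  by (auto simp: poisson_mass_def nonneg_vecs_def PiE_def Pi_def intro!: prod_nonneg)

lemma poisson_mass_sums_to_1:
  assumes "\<theta> \<in> nonneg_vecs d"
  shows "(\<integral>\<^sup>+y. ennreal (poisson_mass d \<theta> y) \<partial>count_space (nat_vecs d)) = 1"
proof -
  define po :: "nat \<Rightarrow> nat pmf" where
    "po j = (if \<theta> j = 0 then return_pmf 0 else poisson_pmf (\<theta> j))" for j
  define P where "P = Pi_pmf {..<d} undefined po"
  have po: "pmf (po j) k = exp (- \<theta> j) * \<theta> j ^ k / fact k" if "j < d" for j k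
  proof -
    have "\<theta> j \<ge> 0" using assms that by (auto simp: nonneg_vecs_def PiE_def Pi_def)
    then show ?thesis by (cases k) (auto simp: po_def)
  qed
  have "poisson_mass d \<theta> y = pmf P y" if "y \<in> nat_vecs d" for y
    unfolding P_def using that
    by (subst pmf_Pi')
       (auto simp: poisson_mass_def po nat_vecs_def PiE_def extensional_def intro!: prod.cong)
  then have "(\<integral>\<^sup>+y. ennreal (poisson_mass d \<theta> y) \<partial>count_space (nat_vecs d)) =
             (\<integral>\<^sup>+y. ennreal (pmf P y) \<partial>count_space (nat_vecs d))"
    by (intro nn_integral_cong) simp
  also have "\<dots> = emeasure (measure_pmf P) (nat_vecs d)"
    by (rule nn_integral_pmf)
  also have "\<dots> = 1"
  proof -
    have "set_pmf P \<subseteq> nat_vecs d"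
      using set_Pi_pmf_subset[of "{..<d}" undefined po]
      by (auto simp: P_def nat_vecs_def PiE_def extensional_def)
    then show ?thesis
      by (simp add: measure_pmf.emeasure_eq_1_AE AE_measure_pmf_iff subset_iff)
  qed
  finally show ?thesis .
qed

lemma poisson_mass_measurable:
  assumes "G \<in> borel_probs d \<Theta>"
  shows "(\<lambda>\<theta>. poisson_mass d \<theta> y) \<in> borel_measurable G"
proof -
  have "(\<lambda>\<theta>. poisson_mass d \<theta> y) \<in> borel_measurable (\<Pi>\<^sub>M j\<in>{..<d}. borel :: real measure)"
    unfolding poisson_mass_def by measurable
  then have "(\<lambda>\<theta>. poisson_mass d \<theta> y) \<in>
      borel_measurable (restrict_space (\<Pi>\<^sub>M j\<in>{..<d}. borel) \<Theta>)"
    by (rule measurable_restrict_space1)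
  then show ?thesis
    using assms by (simp add: borel_probs_def cong: measurable_cong_sets)
qed

lemma pmf_poisson_mixture:
  assumes "\<Theta> \<subseteq> nonneg_vecs d" and G: "G \<in> borel_probs d \<Theta>"
  shows "pmf (poisson_mixture d G) y =
           (if y \<in> nat_vecs d then (\<integral>\<theta>. poisson_mass d \<theta> y \<partial>G) else 0)"
proof -
  interpret prob_space G using G by (simp add: borel_probs_def)
  let ?f = "\<lambda>y. if y \<in> nat_vecs d then (\<integral>\<theta>. poisson_mass d \<theta> y \<partial>G) else 0"
  have "space G = space (restrict_space (\<Pi>\<^sub>M j\<in>{..<d}. borel :: real measure) \<Theta>)"
    using G by (intro sets_eq_imp_space_eq) (simp add: borel_probs_def)
  then have sp: "\<theta> \<in> nonneg_vecs d" if "\<theta> \<in> space G" for \<theta>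
    using that assms(1) by (auto simp: space_restrict_space)
  note [measurable] = poisson_mass_measurable[OF G]
  have cnt: "countable (nat_vecs d)"
    unfolding nat_vecs_def by (intro countable_PiE) auto
  have le1: "poisson_mass d \<theta> y \<le> 1" if "\<theta> \<in> space G" "y \<in> nat_vecs d" for \<theta> y
  proof -
    have "ennreal (poisson_mass d \<theta> y) \<le>
        (\<integral>\<^sup>+y. ennreal (poisson_mass d \<theta> y) \<partial>count_space (nat_vecs d))"
      using that(2) by (rule nn_integral_ge_point)
    then show ?thesis
      using poisson_mass_sums_to_1[OF sp[OF that(1)]] by simp
  qed
  have eq: "ennreal (?f y) = (\<integral>\<^sup>+\<theta>. ennreal (poisson_mass d \<theta> y) \<partial>G)" if "y \<in> nat_vecs d" for y
  proof -
    have "integrable G (\<lambda>\<theta>. poisson_mass d \<theta> y)"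
      using le1 that sp poisson_mass_nonneg
      by (intro integrable_const_bound[of _ 1]) (auto intro!: AE_I2)
    then show ?thesis
      using that sp poisson_mass_nonneg
      by (subst nn_integral_eq_integral) (auto intro!: AE_I2)
  qed
  have "(\<integral>\<^sup>+y. ennreal (?f y) \<partial>count_space UNIV) =
        (\<integral>\<^sup>+y. ennreal (?f y) \<partial>count_space (nat_vecs d))"
    by (subst nn_integral_count_space_indicator[of "nat_vecs d"])
       (auto intro!: nn_integral_cong split: split_indicator)
  also have "\<dots> = (\<integral>\<^sup>+y. (\<integral>\<^sup>+\<theta>. ennreal (poisson_mass d \<theta> y) \<partial>G) \<partial>count_space (nat_vecs d))"
    by (intro nn_integral_cong) (use eq in simp)
  also have "\<dots> = (\<integral>\<^sup>+\<theta>. (\<integral>\<^sup>+y. ennreal (poisson_mass d \<theta> y) \<partial>count_space (nat_vecs d)) \<partial>G)"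
    using cnt by (subst nn_integral_count_space_nn_integral) auto
  also have "\<dots> = (\<integral>\<^sup>+\<theta>. 1 \<partial>G)"
    by (intro nn_integral_cong) (use sp poisson_mass_sums_to_1 in simp)
  also have "\<dots> = 1" by (simp add: emeasure_space_1)
  finally have "(\<integral>\<^sup>+y. ennreal (?f y) \<partial>count_space UNIV) = 1" .
  moreover have "0 \<le> ?f y" for y
    using sp poisson_mass_nonneg by (auto intro!: integral_nonneg_AE AE_I2)
  ultimately show ?thesis
    unfolding poisson_mixture_def by (subst pmf_embed_pmf) auto
qed

end

theory Submission
  imports Defs
begin

text \<open>
  Let \<open>f\<close> be the true mixture and \<open>B = {0..<m}\<^sup>d\<close>. On the event that the whole sample lies in \<open>B\<close>,
  the decomposition property lets us move the mass of \<open>f\<close> outside \<open>B\<close> to one point without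
  changing the distance from the empirical distribution. The upper sandwich bound then involves
  only the \<open>m\<^sup>d\<close> cells of \<open>B\<close>, each of which contributes at most \<open>1 / n\<close> in expectation, and the mass
  \<open>\<epsilon>\<close> of the extra point. By minimality the fitted mixture is at least as close to the empirical
  distribution, so the lower sandwich bound and the triangle inequality give
  a risk of order \<open>m\<^sup>d / n + \<epsilon>\<close>. The complementary event costs at most \<open>2 n \<epsilon>\<close>. A Chernoff
  bound shows which \<open>m\<close> makes \<open>\<epsilon>\<close> of order \<open>d / n\<^sup>2\<close>.
\<close>

section \<open>Squared Hellinger distance\<close>

lemma infsum_ennreal_pmf_le_1: "(\<Sum>\<^sub>\<infinity>y\<in>A. ennreal (pmf p y)) \<le> 1"
proof (rule infsum_le_finite_sums)
  fix F assume "finite F" "F \<subseteq> A"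
  then have "(\<Sum>y\<in>F. ennreal (pmf p y)) = ennreal (measure_pmf.prob p F)"
    by (simp add: measure_measure_pmf_finite)
  then show "(\<Sum>y\<in>F. ennreal (pmf p y)) \<le> 1"
    by simp
qed (simp add: nonneg_summable_on_complete)

text \<open>Expanding the square and dropping the cross term leaves two total masses. This crude
  bound pays for samples that leave the box.\<close>

lemma hellinger_sq_le_2: "hellinger_sq d p q \<le> 2"
proof -
  have "hellinger_sq d p q \<le> (\<Sum>\<^sub>\<infinity>y\<in>nat_vecs d. ennreal (pmf p y) + ennreal (pmf q y))"
    unfolding hellinger_sq_def
  proof (rule infsum_mono)
    fix y
    have "(sqrt (pmf p y) - sqrt (pmf q y))\<^sup>2 \<le> pmf p y + pmf q y"
      by (simp add: power2_diff)
    then show "ennreal ((sqrt (pmf p y) - sqrt (pmf q y))\<^sup>2) \<le> ennreal (pmf p y) + ennreal (pmf q y)"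
      by (simp flip: ennreal_plus)
  qed (simp_all add: nonneg_summable_on_complete)
  also have "\<dots> \<le> 1 + 1"
    by (subst infsum_add) (simp_all add: add_mono infsum_ennreal_pmf_le_1 nonneg_summable_on_complete del: one_add_one)
  finally show ?thesis by simp
qed

text \<open>Termwise this is \<open>(2 * a - b - c)\<^sup>2 >= 0\<close>. The intermediate point
  \<open>p\<close> will be the empirical distribution.\<close>

lemma hellinger_sq_triangle:
  "hellinger_sq d q r \<le> 2 * (hellinger_sq d p q + hellinger_sq d p r)"
proof -
  let ?h = "\<lambda>p q y. ennreal ((sqrt (pmf p y) - sqrt (pmf q y))\<^sup>2)"
  have "hellinger_sq d q r \<le> (\<Sum>\<^sub>\<infinity>y\<in>nat_vecs d. (?h p q y + ?h p r y) + (?h p q y + ?h p r y))"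
    unfolding hellinger_sq_def
  proof (rule infsum_mono)
    fix y
    have "(b - c)\<^sup>2 \<le> 2 * ((a - b)\<^sup>2 + (a - c)\<^sup>2)" for a b c :: real
      using zero_le_power2[of "2 * a - b - c"] by (simp add: power2_eq_square algebra_simps)
    then have "?h q r y \<le> ennreal (2 * ((sqrt (pmf p y) - sqrt (pmf q y))\<^sup>2 +
        (sqrt (pmf p y) - sqrt (pmf r y))\<^sup>2))"
      by (intro ennreal_leI)
    then show "?h q r y \<le> (?h p q y + ?h p r y) + (?h p q y + ?h p r y)"
      by (simp add: ennreal_mult distrib_left flip: mult_2)
  qed (simp_all add: nonneg_summable_on_complete)
  also have "\<dots> = 2 * (hellinger_sq d p q + hellinger_sq d p r)"
    unfolding hellinger_sq_def
    by (simp add: infsum_add nonneg_summable_on_complete mult_2)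
  finally show ?thesis .
qed

section \<open>Truncating the second argument of the distance\<close>

text \<open>Off the support of \<open>p\<close> every summand is \<open>l 0 b = 0\<close>, and
  \<open>t\<close> depends on the first argument alone.\<close>

lemma decomposition_property_cong:
  assumes "decomposition_property d D"
    and "p \<in> pmfs d" "q \<in> pmfs d" "r \<in> pmfs d"
    and eq: "\<And>y. y \<in> set_pmf p \<Longrightarrow> pmf q y = pmf r y"
  shows "D p q = D p r"
proof -
  from assms(1) obtain t l where
    tl: "\<And>q\<^sub>1 q\<^sub>2. q\<^sub>1 \<in> pmfs d \<Longrightarrow> q\<^sub>2 \<in> pmfs d \<Longrightarrow> \<exists>S.
           ((\<lambda>y. l (pmf q\<^sub>1 y) (pmf q\<^sub>2 y)) has_sum S) (nat_vecs d) \<and>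
           enn2ereal (D q\<^sub>1 q\<^sub>2) = ereal (t q\<^sub>1) + S"
    and l0: "\<And>b::real. b \<ge> 0 \<Longrightarrow> l (0::real) b = (0::ereal)"
    unfolding decomposition_property_def by (elim exE conjE) blast
  from tl[OF \<open>p \<in> pmfs d\<close> \<open>q \<in> pmfs d\<close>] obtain S where
    S: "((\<lambda>y. l (pmf p y) (pmf q y)) has_sum S) (nat_vecs d)" "enn2ereal (D p q) = ereal (t p) + S"
    by blast
  from tl[OF \<open>p \<in> pmfs d\<close> \<open>r \<in> pmfs d\<close>] obtain S' where
    S': "((\<lambda>y. l (pmf p y) (pmf r y)) has_sum S') (nat_vecs d)" "enn2ereal (D p r) = ereal (t p) + S'"
    by blast
  have "l (pmf p y) (pmf q y) = l (pmf p y) (pmf r y)" for y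
    using eq[of y] l0 by (cases "y \<in> set_pmf p") (auto simp: set_pmf_iff)
  then have "S = S'"
    using infsumI[OF S(1)] infsumI[OF S'(1)] by simp
  then show ?thesis
    using S(2) S'(2) by (metis enn2ereal_inject)
qed

text \<open>
  Since \<open>D p\<close> only sees the values of its second argument on the support of \<open>p\<close>, all the mass of
  \<open>f\<close> outside \<open>B\<close> may be moved to the single point \<open>z\<close>; the \<open>\<chi>\<^sup>2\<close>-distance to the modified
  distribution has only finitely many terms.
\<close>

lemma distance_le_truncated_chi_sq:
  assumes "decomposition_property d D" "sandwich_property \<kappa>\<^sub>1 \<kappa>\<^sub>2 d D"
    and B: "finite B" "B \<subseteq> nat_vecs d" and z: "z \<in> nat_vecs d" "z \<notin> B"
    and f: "f \<in> pmfs d" and p: "set_pmf p \<subseteq> B"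
  shows "D p f \<le> ennreal \<kappa>\<^sub>2 *
    ((\<Sum>y\<in>B. ennreal ((pmf p y - pmf f y)\<^sup>2) / ennreal (pmf f y)) +
      ennreal (measure_pmf.prob f (- B)))"
proof -
  define r where "r = map_pmf (\<lambda>y. if y \<in> B then y else z) f"
  have rB: "pmf r y = pmf f y" if "y \<in> B" for y
  proof -
    have "(\<lambda>y. if y \<in> B then y else z) -` {y} = {y}"
      using that z by auto
    then show ?thesis by (simp add: r_def pmf_map measure_pmf_single)
  qed
  have "(\<lambda>y. if y \<in> B then y else z) -` {z} = - B"
    using z by auto
  then have rz: "pmf r z = measure_pmf.prob f (- B)"
    by (simp add: r_def pmf_map)
  have r: "r \<in> pmfs d" and p': "p \<in> pmfs d"
    using B z p by (auto simp: r_def pmfs_def)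
  have r0: "pmf r y = 0" if "y \<notin> insert z B" for y
    using that by (auto simp: r_def pmf_eq_0_set_pmf split: if_splits)
  have p0: "pmf p y = 0" if "y \<notin> B" for y
    using that p by (auto simp: pmf_eq_0_set_pmf)
  have "D p f = D p r"
    using assms(1) p' f r by (rule decomposition_property_cong) (use p rB in auto)
  also have "\<dots> \<le> ennreal \<kappa>\<^sub>2 * chi_sq d p r"
    using assms(2) p' r by (auto simp: sandwich_property_def)
  \<comment> \<open>Elsewhere both mass functions vanish, and 0 / 0 = 0 in
    \<open>ennreal\<close>.\<close>
  also have "chi_sq d p r = (\<Sum>\<^sub>\<infinity>y\<in>insert z B. ennreal ((pmf p y - pmf r y)\<^sup>2) / ennreal (pmf r y))"
    unfolding chi_sq_def by (rule infsum_cong_neutral) (use B z r0 p0 in auto)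
  also have "\<dots> = (\<Sum>y\<in>B. ennreal ((pmf p y - pmf r y)\<^sup>2) / ennreal (pmf r y)) +
      ennreal ((pmf p z - pmf r z)\<^sup>2) / ennreal (pmf r z)"
    using B z by (simp add: add.commute)
  \<comment> \<open>Since \<open>p\<close> has no mass at \<open>z\<close>, the term is
    \<open>(pmf r z)\<^sup>2 / pmf r z\<close>, which is the collected mass \<open>pmf r z\<close>,
    or 0 if that mass is zero.\<close>
  also have "ennreal ((pmf p z - pmf r z)\<^sup>2) / ennreal (pmf r z) \<le> ennreal (measure_pmf.prob f (- B))"
    using p0[OF z(2)] rz
    by (cases "measure_pmf.prob f (- B) = 0")
       (auto simp: divide_ennreal zero_less_measure_iff power2_eq_square)
  also have "(\<Sum>y\<in>B. ennreal ((pmf p y - pmf r y)\<^sup>2) / ennreal (pmf r y)) =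
      (\<Sum>y\<in>B. ennreal ((pmf p y - pmf f y)\<^sup>2) / ennreal (pmf f y))"
    by (intro sum.cong) (simp_all add: rB)
  finally show ?thesis
    by (simp add: mult_left_mono)
qed

section \<open>Mean square deviation of the empirical distribution\<close>

text \<open>Additivity of the variance, by drawing one coordinate at a time. The free shift
  \<open>c\<close> absorbs the drawn value in the induction hypothesis, and the cross term
  \<open>2 * c * g y\<close> integrates to zero. Boundedness supplies integrability.\<close>

lemma nn_integral_square_sum_Pi_pmf:
  fixes g :: "'a \<Rightarrow> real" and n :: nat
  assumes bounded: "\<And>y. \<bar>g y\<bar> \<le> C" and mean0: "measure_pmf.expectation p g = 0"
  shows "(\<integral>\<^sup>+Y. ennreal ((c + (\<Sum>i<n. g (Y i)))\<^sup>2) \<partial>measure_pmf (Pi_pmf {..<n} dflt (\<lambda>_. p))) =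
    ennreal (c\<^sup>2 + n * measure_pmf.expectation p (\<lambda>y. (g y)\<^sup>2))"
proof (induction n arbitrary: c)
  case 0
  then show ?case by simp
next
  case (Suc n)
  let ?v = "measure_pmf.expectation p (\<lambda>y. (g y)\<^sup>2)"
  have int [simp]: "integrable p g"
    using bounded by (intro measure_pmf.integrable_const_bound[where B = C]) auto
  have "(g y)\<^sup>2 \<le> C\<^sup>2" for y
    using power_mono[OF bounded[of y], of 2] by simp
  then have int2 [simp]: "integrable p (\<lambda>y. (g y)\<^sup>2)"
    by (intro measure_pmf.integrable_const_bound[where B = "C\<^sup>2"]) auto
  have "(\<integral>\<^sup>+Y. ennreal ((c + (\<Sum>i<Suc n. g (Y i)))\<^sup>2) \<partial>measure_pmf (Pi_pmf {..<Suc n} dflt (\<lambda>_. p))) =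
    (\<integral>\<^sup>+y. (\<integral>\<^sup>+Y. ennreal ((c + g y + (\<Sum>i<n. g (Y i)))\<^sup>2) \<partial>measure_pmf (Pi_pmf {..<n} dflt (\<lambda>_. p))) \<partial>p)"
    by (simp add: lessThan_Suc Pi_pmf_insert nn_integral_pair_pmf' case_prod_unfold add_ac)
  also have "\<dots> = (\<integral>\<^sup>+y. ennreal ((c + g y)\<^sup>2 + real n * ?v) \<partial>p)"
    by (simp only: Suc.IH)
  also have "\<dots> = ennreal (measure_pmf.expectation p (\<lambda>y. (c + g y)\<^sup>2 + real n * ?v))"
    by (rule nn_integral_eq_integral, simp add: power2_sum, simp)
  also have "measure_pmf.expectation p (\<lambda>y. (c + g y)\<^sup>2 + real n * ?v) = c\<^sup>2 + real (Suc n) * ?v"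
    by (simp add: power2_sum mean0 algebra_simps)
  finally show ?case .
qed

lemma pmf_empirical:
  assumes "n > 0"
  shows "pmf (empirical n Y) y = (\<Sum>i<n. indicator {y} (Y i)) / n"
proof -
  have "pmf (empirical n Y) y = card ({..<n} \<inter> Y -` {y}) / n"
    using assms by (simp add: empirical_def pmf_map measure_pmf_of_set Int_commute lessThan_empty_iff)
  also have "real (card ({..<n} \<inter> Y -` {y})) = (\<Sum>i<n. indicator {y} (Y i))"
    by (simp add: indicator_def sum.If_cases vimage_def)
  finally show ?thesis .
qed

text \<open>The indicators of \<open>Y i = y\<close> are independent Bernoulli variables, so the
  left side is \<open>pmf f y * (1 - pmf f y) / n\<close>. The weaker bound is kept because dividing
  by \<open>pmf f y\<close> turns it into \<open>1 / n\<close> for each cell.\<close>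

lemma nn_integral_empirical_deviation:
  assumes "n > 0"
  shows "(\<integral>\<^sup>+Y. ennreal ((pmf (empirical n Y) y - pmf f y)\<^sup>2) \<partial>measure_pmf (iid_sample n f))
    \<le> ennreal (pmf f y / n)"
proof -
  define g where "g x = (indicator {y} x - pmf f y :: real)" for x
  have "(\<Sum>i<n. g (Y i)) / n = pmf (empirical n Y) y - pmf f y" for Y
    using assms by (simp add: g_def sum_subtractf diff_divide_distrib pmf_empirical)
  from this[symmetric] have dev: "ennreal ((pmf (empirical n Y) y - pmf f y)\<^sup>2) =
      ennreal (1 / n\<^sup>2) * ennreal ((0 + (\<Sum>i<n. g (Y i)))\<^sup>2)" for Y
    by (simp add: power_divide flip: ennreal_mult')
  have int: "integrable f (indicator {y} :: _ \<Rightarrow> real)"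
    by (intro measure_pmf.integrable_const_bound[where B = 1]) auto
  \<comment> \<open>An indicator equals its own square, so \<open>(g x)\<^sup>2\<close> is affine in
    it.\<close>
  have g2: "(g x)\<^sup>2 = (1 - 2 * pmf f y) * indicator {y} x + (pmf f y)\<^sup>2" for x
    by (auto simp: g_def power2_eq_square algebra_simps split: split_indicator)
  have ex_ind: "measure_pmf.expectation f (indicator {y}) = pmf f y"
    by (simp add: measure_pmf_single)
  have "measure_pmf.expectation f g = 0"
    unfolding g_def using int by (simp add: measure_pmf_single)
  moreover have "\<bar>g x\<bar> \<le> 1" for x
    by (auto simp: g_def pmf_le_1 split: split_indicator)
  ultimately have "(\<integral>\<^sup>+Y. ennreal ((0 + (\<Sum>i<n. g (Y i)))\<^sup>2) \<partial>measure_pmf (iid_sample n f)) =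
      ennreal (0\<^sup>2 + n * measure_pmf.expectation f (\<lambda>x. (g x)\<^sup>2))"
    unfolding iid_sample_def by (intro nn_integral_square_sum_Pi_pmf)
  also have "measure_pmf.expectation f (\<lambda>x. (g x)\<^sup>2) = pmf f y - (pmf f y)\<^sup>2"
    unfolding g2 using int by (simp add: measure_pmf_single power2_eq_square algebra_simps)
  also have "ennreal (0\<^sup>2 + n * (pmf f y - (pmf f y)\<^sup>2)) \<le> ennreal (n * pmf f y)"
    by (intro ennreal_leI) (simp add: algebra_simps)
  finally have "(\<integral>\<^sup>+Y. ennreal ((pmf (empirical n Y) y - pmf f y)\<^sup>2) \<partial>measure_pmf (iid_sample n f))
      \<le> ennreal (1 / n\<^sup>2) * ennreal (n * pmf f y)"
    unfolding dev by (simp add: nn_integral_cmult mult_left_mono)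
  also have "\<dots> = ennreal (pmf f y / n)"
    using assms by (simp add: power2_eq_square flip: ennreal_mult')
  finally show ?thesis .
qed

section \<open>Risk bound from a finite set of cells\<close>

lemma poisson_mixture_in_pmfs:
  assumes "G \<in> borel_probs d (nonneg_vecs d)"
  shows "poisson_mixture d G \<in> pmfs d"
  using pmf_poisson_mixture[OF subset_refl assms] by (auto simp: pmfs_def set_pmf_iff split: if_splits)

text \<open>Multiplying by the real \<open>1 / a\<close> also covers infinite \<open>x\<close> and
  \<open>y\<close>.\<close>

lemma ennreal_mult_le_imp_le_divide:
  assumes "0 < a" "ennreal a * x \<le> ennreal b * y"
  shows "x \<le> ennreal (b / a) * y"
proof -
  have "x = ennreal (1 / a) * (ennreal a * x)"
    using assms(1) by (simp flip: mult.assoc ennreal_mult')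
  also have "\<dots> \<le> ennreal (1 / a) * (ennreal b * y)"
    using assms(2) by (rule mult_left_mono) simp
  also have "\<dots> = ennreal (b / a) * y"
    using assms(1) by (simp flip: mult.assoc ennreal_mult')
  finally show ?thesis .
qed

text \<open>Strictness of \<open>B \<subset> nat_vecs d\<close> provides the point that receives the
  outside mass. Measurability of \<open>Ghat\<close> is no issue, as the sample has a discrete
  law.\<close>

lemma hellinger_risk_le:
  assumes pos: "0 < \<kappa>\<^sub>1" "0 < \<kappa>\<^sub>2" "0 < n"
    and D: "decomposition_property d D" "sandwich_property \<kappa>\<^sub>1 \<kappa>\<^sub>2 d D"
    and Ghat: "min_distance_estimator d n D Ghat"
    and G: "G \<in> borel_probs d (nonneg_vecs d)"
    and B: "finite B" "B \<subset> nat_vecs d"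
    and \<epsilon>: "measure_pmf.prob (poisson_mixture d G) (- B) \<le> \<epsilon>"
  shows "hellinger_risk d n Ghat G \<le> ennreal (4 * (\<kappa>\<^sub>2 / \<kappa>\<^sub>1) * (card B / n + \<epsilon>) + 2 * (n * \<epsilon>))"
proof -
  define f where "f = poisson_mixture d G"
  define T where
    "T Y = (\<Sum>y\<in>B. ennreal ((pmf (empirical n Y) y - pmf f y)\<^sup>2) / ennreal (pmf f y))" for Y
  define M where "M = \<kappa>\<^sub>2 / \<kappa>\<^sub>1"
  have M: "M > 0" using pos by (simp add: M_def)
  have \<epsilon>0: "\<epsilon> \<ge> 0"
    using \<epsilon> measure_nonneg order_trans by blast
  have f: "f \<in> pmfs d"
    unfolding f_def using G by (rule poisson_mixture_in_pmfs)
  obtain z where z: "z \<in> nat_vecs d" "z \<notin> B"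
    using B by blast
  \<comment> \<open>The sum counts the observations outside \<open>B\<close>; it is at least 1 as
    soon as the sample leaves \<open>B\<close>, so twice the sum dominates the trivial bound
    2.\<close>
  have *: "hellinger_sq d (poisson_mixture d (Ghat Y)) f \<le>
      ennreal (4 * M) * (T Y + ennreal \<epsilon>) + 2 * (\<Sum>i<n. indicator (- B) (Y i))"
    if Y: "Y \<in> set_pmf (iid_sample n f)" for Y
  proof (cases "\<forall>i<n. Y i \<in> B")
    case True
    define p where "p = empirical n Y"
    define q where "q = poisson_mixture d (Ghat Y)"
    have Y': "Y \<in> {..<n} \<rightarrow>\<^sub>E nat_vecs d"
      using Y True B set_Pi_pmf_subset[of "{..<n}" undefined "\<lambda>_. f"]
      by (auto simp: iid_sample_def PiE_def extensional_def)
    have p: "set_pmf p \<subseteq> B"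
      using True pos by (auto simp: p_def empirical_def lessThan_empty_iff)
    then have p': "p \<in> pmfs d"
      using B by (auto simp: pmfs_def)
    have "is_arg_min (\<lambda>Q. D p (poisson_mixture d Q)) (\<lambda>Q. Q \<in> borel_probs d (nonneg_vecs d)) (Ghat Y)"
      using Ghat Y' by (auto simp: min_distance_estimator_def p_def)
    \<comment> \<open>The true prior \<open>G\<close> is itself a competitor in the
      minimisation.\<close>
    then have q: "q \<in> pmfs d" and "D p q \<le> D p f"
      using G by (auto simp: is_arg_min_def q_def f_def poisson_mixture_in_pmfs not_less)
    have "D p f \<le> ennreal \<kappa>\<^sub>2 * (T Y + ennreal (measure_pmf.prob f (- B)))"
      unfolding T_def p_def[symmetric]
      using D B(1) psubset_imp_subset[OF B(2)] z f p by (rule distance_le_truncated_chi_sq)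
    also have "\<dots> \<le> ennreal \<kappa>\<^sub>2 * (T Y + ennreal \<epsilon>)"
      using \<epsilon> by (intro mult_left_mono add_left_mono ennreal_leI) (auto simp: f_def)
    finally have Df: "D p f \<le> ennreal \<kappa>\<^sub>2 * (T Y + ennreal \<epsilon>)" .
    \<comment> \<open>Applied both to the fitted mixture \<open>q\<close> and to \<open>f\<close>;
      together with the factor 2 of the triangle inequality this yields
      \<open>4 * M\<close>.\<close>
    have H: "hellinger_sq d p r \<le> ennreal M * (T Y + ennreal \<epsilon>)"
      if "r \<in> pmfs d" "D p r \<le> D p f" for r
    proof -
      have "ennreal \<kappa>\<^sub>1 * hellinger_sq d p r \<le> D p r"
        using D(2) p' that(1) by (auto simp: sandwich_property_def)
      also note that(2)
      also note Df
      finally show ?thesis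
        unfolding M_def using pos(1) by (intro ennreal_mult_le_imp_le_divide)
    qed
    have "hellinger_sq d q f \<le> 2 * (hellinger_sq d p q + hellinger_sq d p f)"
      by (rule hellinger_sq_triangle)
    also have "\<dots> \<le> 2 * (ennreal M * (T Y + ennreal \<epsilon>) + ennreal M * (T Y + ennreal \<epsilon>))"
      using q f \<open>D p q \<le> D p f\<close> by (intro mult_left_mono add_mono H) auto
    also have "\<dots> = ennreal (4 * M) * (T Y + ennreal \<epsilon>)"
      using M by (simp add: ennreal_mult' mult.assoc flip: mult_2)
    finally show ?thesis
      by (simp add: q_def add_increasing2)
  next
    case False
    then obtain i where "i < n" "Y i \<notin> B" by blast
    then have "(1::ennreal) \<le> (\<Sum>i<n. indicator (- B) (Y i))"
      by (intro order_trans[OF _ member_le_sum[of i]]) auto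
    then have "2 * 1 \<le> 2 * (\<Sum>i<n. indicator (- B) (Y i) :: ennreal)"
      by (rule mult_left_mono) simp
    then show ?thesis
      using hellinger_sq_le_2 by (auto intro!: add_increasing intro: order_trans)
  qed
  have ind: "(\<integral>\<^sup>+Y. indicator (- B) (Y i) \<partial>measure_pmf (iid_sample n f)) \<le> ennreal \<epsilon>" if "i < n" for i
  proof -
    have "(\<integral>\<^sup>+Y. indicator (- B) (Y i) \<partial>measure_pmf (iid_sample n f)) =
        (\<integral>\<^sup>+y. indicator (- B) y \<partial>measure_pmf (map_pmf (\<lambda>Y. Y i) (iid_sample n f)))"
      by simp
    also have "map_pmf (\<lambda>Y. Y i) (iid_sample n f) = f"
      using that by (simp add: iid_sample_def Pi_pmf_component)
    finally show ?thesis
      using \<epsilon> by (simp add: f_def measure_pmf.emeasure_eq_measure ennreal_leI)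
  qed
  have T: "(\<integral>\<^sup>+Y. T Y \<partial>measure_pmf (iid_sample n f)) \<le> ennreal (card B / n)"
  proof -
    have "(\<integral>\<^sup>+Y. T Y \<partial>measure_pmf (iid_sample n f)) =
        (\<Sum>y\<in>B. (\<integral>\<^sup>+Y. ennreal ((pmf (empirical n Y) y - pmf f y)\<^sup>2)
           \<partial>measure_pmf (iid_sample n f)) / ennreal (pmf f y))"
      unfolding T_def by (simp add: nn_integral_sum nn_integral_divide)
    also have "\<dots> \<le> (\<Sum>y\<in>B. ennreal (pmf f y / n) / ennreal (pmf f y))"
      using pos by (intro sum_mono divide_right_mono_ennreal nn_integral_empirical_deviation)
    \<comment> \<open>Only an inequality, since cells of zero mass contribute 0.\<close>
    also have "\<dots> \<le> (\<Sum>y\<in>B. ennreal (1 / n))"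
    proof (rule sum_mono)
      fix y
      show "ennreal (pmf f y / n) / ennreal (pmf f y) \<le> ennreal (1 / n)"
      proof (cases "pmf f y = 0")
        case False
        then have "0 < pmf f y"
          using pmf_nonneg[of f y] by linarith
        then show ?thesis
          by (simp add: divide_ennreal)
      qed simp
    qed
    also have "\<dots> = ennreal (card B / n)"
      by (subst sum_ennreal) auto
    finally show ?thesis .
  qed
  have "hellinger_risk d n Ghat G \<le>
      (\<integral>\<^sup>+Y. ennreal (4 * M) * (T Y + ennreal \<epsilon>) + 2 * (\<Sum>i<n. indicator (- B) (Y i))
        \<partial>measure_pmf (iid_sample n f))"
    unfolding hellinger_risk_def f_def[symmetric]
    using * by (intro nn_integral_mono_AE AE_pmfI)
  also have "\<dots> = ennreal (4 * M) * ((\<integral>\<^sup>+Y. T Y \<partial>measure_pmf (iid_sample n f)) + ennreal \<epsilon>) +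
      2 * (\<Sum>i<n. \<integral>\<^sup>+Y. indicator (- B) (Y i) \<partial>measure_pmf (iid_sample n f))"
    by (simp add: nn_integral_add nn_integral_cmult nn_integral_sum)
  also have "\<dots> \<le> ennreal (4 * M) * (ennreal (card B / n) + ennreal \<epsilon>) + 2 * (\<Sum>i<n. ennreal \<epsilon>)"
    using T ind by (intro add_mono mult_left_mono sum_mono) auto
  also have "\<dots> = ennreal (4 * M * (card B / n + \<epsilon>) + 2 * (n * \<epsilon>))"
  proof -
    have "(\<Sum>i<n. ennreal \<epsilon>) = ennreal (n * \<epsilon>)"
      using \<epsilon>0 by (subst sum_ennreal) auto
    moreover have "ennreal (card B / n) + ennreal \<epsilon> = ennreal (card B / n + \<epsilon>)"
      using \<epsilon>0 by (intro ennreal_plus[symmetric]) auto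
    moreover have "2 * ennreal (n * \<epsilon>) = ennreal (2 * (n * \<epsilon>))"
      using \<epsilon>0 by (simp add: ennreal_mult)
    moreover have "ennreal (4 * M) * ennreal (card B / n + \<epsilon>) = ennreal (4 * M * (card B / n + \<epsilon>))"
      using M by (intro ennreal_mult'[symmetric]) auto
    ultimately show ?thesis
      using M \<epsilon>0 by (simp only:) (intro ennreal_plus[symmetric]; simp)
  qed
  finally show ?thesis
    by (simp only: M_def)
qed

section \<open>Tails of Poisson mixtures\<close>

text \<open>
  Weighting the mass function by \<open>x\<^bsup>y j\<^esup>\<close> multiplies the \<open>j\<close>-th rate by \<open>x\<close>, up to a constant. Hence
  the moment generating function needed for the Chernoff bound comes from the normalisation of
  \<^const>\<open>poisson_mass\<close>, with no series to sum.
\<close>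

lemma poisson_mass_scale:
  assumes "j < d"
  shows "poisson_mass d \<theta> y * x ^ y j = exp (\<theta> j * (x - 1)) * poisson_mass d (\<theta>(j := x * \<theta> j)) y"
proof -
  let ?P = "\<Prod>k\<in>{..<d} - {j}. exp (- \<theta> k) * \<theta> k ^ y k / fact (y k)"
  have 1: "poisson_mass d \<theta> y = exp (- \<theta> j) * \<theta> j ^ y j / fact (y j) * ?P"
    unfolding poisson_mass_def using assms by (subst prod.remove[of _ j]) auto
  have 2: "poisson_mass d (\<theta>(j := x * \<theta> j)) y =
      exp (- (x * \<theta> j)) * (x * \<theta> j) ^ y j / fact (y j) * ?P"
    unfolding poisson_mass_def using assms by (subst prod.remove[of _ j]) (auto intro!: prod.cong)
  have "exp (\<theta> j * (x - 1)) * exp (- (x * \<theta> j)) = exp (- \<theta> j)"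
    by (simp add: algebra_simps flip: exp_add)
  then show ?thesis
    unfolding 1 2 by (simp add: power_mult_distrib field_simps)
qed

text \<open>Where \<open>m <= y j\<close>, the factor \<open>x ^ y j / x ^ m\<close> is at least 1.
  Once it is inserted, the tilted masses sum to 1 and only the constant remains.\<close>

lemma poisson_mass_tail_le:
  assumes \<theta>: "\<theta> \<in> nonneg_vecs d" and j: "j < d" and x: "1 \<le> x"
  shows "(\<integral>\<^sup>+y. ennreal (poisson_mass d \<theta> y) * indicator {y. m \<le> y j} y \<partial>count_space (nat_vecs d))
    \<le> ennreal (exp (\<theta> j * (x - 1)) / x ^ m)"
proof -
  let ?\<theta>' = "\<theta>(j := x * \<theta> j)" and ?c = "exp (\<theta> j * (x - 1)) / x ^ m"
  have \<theta>': "?\<theta>' \<in> nonneg_vecs d"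
    using \<theta> j x by (auto simp: nonneg_vecs_def PiE_def Pi_def extensional_def)
  have "ennreal (poisson_mass d \<theta> y) * indicator {y. m \<le> y j} y \<le>
      ennreal ?c * ennreal (poisson_mass d ?\<theta>' y)" for y
  proof (cases "m \<le> y j")
    case True
    have "poisson_mass d \<theta> y * x ^ m \<le> poisson_mass d \<theta> y * x ^ y j"
      using True x poisson_mass_nonneg[OF \<theta>] by (intro mult_left_mono power_increasing) auto
    also have "\<dots> = exp (\<theta> j * (x - 1)) * poisson_mass d ?\<theta>' y"
      by (rule poisson_mass_scale[OF j])
    finally have "poisson_mass d \<theta> y \<le> ?c * poisson_mass d ?\<theta>' y"
      using x by (simp add: field_simps)
    then show ?thesis
      using True x by (simp add: ennreal_leI flip: ennreal_mult')
  qed simp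
  then have "(\<integral>\<^sup>+y. ennreal (poisson_mass d \<theta> y) * indicator {y. m \<le> y j} y \<partial>count_space (nat_vecs d))
      \<le> (\<integral>\<^sup>+y. ennreal ?c * ennreal (poisson_mass d ?\<theta>' y) \<partial>count_space (nat_vecs d))"
    by (intro nn_integral_mono)
  also have "\<dots> = ennreal ?c"
    by (simp add: nn_integral_cmult poisson_mass_sums_to_1[OF \<theta>'])
  finally show ?thesis .
qed

lemma space_borel_probs: "G \<in> borel_probs d \<Theta> \<Longrightarrow> space G \<subseteq> \<Theta>"
  by (auto simp: borel_probs_def space_restrict_space dest!: sets_eq_imp_space_eq)

lemma measurable_component_borel_probs:
  assumes "G \<in> borel_probs d \<Theta>" "j < d"
  shows "(\<lambda>\<theta>. \<theta> j) \<in> borel_measurable G"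
proof -
  have "(\<lambda>\<theta>. \<theta> j) \<in> borel_measurable (\<Pi>\<^sub>M j\<in>{..<d}. borel :: real measure)"
    using assms(2) by (intro measurable_component_singleton) simp
  then have "(\<lambda>\<theta>. \<theta> j) \<in> borel_measurable (restrict_space (\<Pi>\<^sub>M j\<in>{..<d}. borel) \<Theta>)"
    by (rule measurable_restrict_space1)
  then show ?thesis
    using assms(1) by (simp add: borel_probs_def cong: measurable_cong_sets)
qed

text \<open>The prior is split at the threshold \<open>t\<close>: rates above \<open>t\<close> are
  charged their full prior probability, while below \<open>t\<close> the Chernoff bound is monotone
  in the rate. The choice of \<open>t\<close> and \<open>x\<close> is left to the two
  applications.\<close>

lemma prob_poisson_mixture_tail_le:
  assumes G: "G \<in> borel_probs d (nonneg_vecs d)" and j: "j < d" and x: "1 \<le> x"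
  shows "measure_pmf.prob (poisson_mixture d G) {y. m \<le> y j} \<le>
    measure G {\<theta> \<in> space G. t < \<theta> j} + exp (t * (x - 1)) / x ^ m"
proof -
  interpret prob_space G using G by (simp add: borel_probs_def)
  let ?f = "poisson_mixture d G" and ?c = "exp (t * (x - 1)) / x ^ m"
  note sp = subsetD[OF space_borel_probs[OF G]]
  note [measurable] = poisson_mass_measurable[OF G] measurable_component_borel_probs[OF G j]
  have cnt: "countable (nat_vecs d)"
    unfolding nat_vecs_def by (intro countable_PiE) auto
  \<comment> \<open>As an inequality this needs no separate finiteness argument:
    \<open>enn2real\<close> sends infinity to 0.\<close>
  have pmf_le: "ennreal (pmf ?f y) \<le> (\<integral>\<^sup>+\<theta>. ennreal (poisson_mass d \<theta> y) \<partial>G)"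
    if "y \<in> nat_vecs d" for y
  proof -
    have "pmf ?f y = enn2real (\<integral>\<^sup>+\<theta>. ennreal (poisson_mass d \<theta> y) \<partial>G)"
      using that sp poisson_mass_nonneg
      by (subst pmf_poisson_mixture[OF subset_refl G]) (auto intro!: integral_eq_nn_integral AE_I2)
    then show ?thesis
      by (simp add: ennreal_enn2real_if)
  qed
  have "ennreal (measure_pmf.prob ?f {y. m \<le> y j}) =
      (\<integral>\<^sup>+y. ennreal (pmf ?f y) * indicator {y. m \<le> y j} y \<partial>count_space UNIV)"
    by (simp add: nn_integral_pmf measure_pmf.emeasure_eq_measure flip: nn_integral_count_space_indicator)
  also have "\<dots> = (\<integral>\<^sup>+y. ennreal (pmf ?f y) * indicator {y. m \<le> y j} y \<partial>count_space (nat_vecs d))"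
    by (subst nn_integral_count_space_indicator[of "nat_vecs d"])
       (auto intro!: nn_integral_cong simp: pmf_poisson_mixture[OF subset_refl G] split: split_indicator)
  also have "\<dots> \<le> (\<integral>\<^sup>+y. (\<integral>\<^sup>+\<theta>. ennreal (poisson_mass d \<theta> y) \<partial>G) * indicator {y. m \<le> y j} y
      \<partial>count_space (nat_vecs d))"
    using pmf_le by (intro nn_integral_mono mult_right_mono) auto
  also have "\<dots> = (\<integral>\<^sup>+y. (\<integral>\<^sup>+\<theta>. ennreal (poisson_mass d \<theta> y) * indicator {y. m \<le> y j} y \<partial>G)
      \<partial>count_space (nat_vecs d))"
    by (simp add: nn_integral_multc)
  also have "\<dots> = (\<integral>\<^sup>+\<theta>. (\<integral>\<^sup>+y. ennreal (poisson_mass d \<theta> y) * indicator {y. m \<le> y j} y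
      \<partial>count_space (nat_vecs d)) \<partial>G)"
    using cnt by (subst nn_integral_count_space_nn_integral) auto
  also have "\<dots> \<le> (\<integral>\<^sup>+\<theta>. indicator {\<theta> \<in> space G. t < \<theta> j} \<theta> + ennreal ?c \<partial>G)"
  proof (rule nn_integral_mono)
    fix \<theta> assume \<theta>: "\<theta> \<in> space G"
    let ?I = "\<integral>\<^sup>+y. ennreal (poisson_mass d \<theta> y) * indicator {y. m \<le> y j} y \<partial>count_space (nat_vecs d)"
    show "?I \<le> indicator {\<theta> \<in> space G. t < \<theta> j} \<theta> + ennreal ?c"
    proof (cases "t < \<theta> j")
      case True
      have "?I \<le> (\<integral>\<^sup>+y. ennreal (poisson_mass d \<theta> y) \<partial>count_space (nat_vecs d))"
        by (intro nn_integral_mono) (auto split: split_indicator)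
      then show ?thesis
        using True \<theta> poisson_mass_sums_to_1[OF sp[OF \<theta>]] by (simp add: add_increasing2)
    next
      case False
      have "?I \<le> ennreal (exp (\<theta> j * (x - 1)) / x ^ m)"
        by (rule poisson_mass_tail_le[OF sp[OF \<theta>] j x])
      also have "\<dots> \<le> ennreal ?c"
        using False x by (intro ennreal_leI divide_right_mono) (auto intro!: mult_right_mono)
      finally show ?thesis
        using False by simp
    qed
  qed
  also have "\<dots> = ennreal (measure G {\<theta> \<in> space G. t < \<theta> j} + ?c)"
    using x by (simp add: nn_integral_add emeasure_eq_measure prob_space)
  finally show ?thesis
    using x by (subst (asm) ennreal_le_iff) auto
qed

section \<open>From coordinate tails to the rate\<close>

text \<open>A union bound over coordinates, after intersecting with the support to discard
  non-extensional functions.\<close>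

lemma prob_outside_box_le:
  assumes "f \<in> pmfs d" and tail: "\<And>j. j < d \<Longrightarrow> measure_pmf.prob f {y. m \<le> y j} \<le> \<tau>"
  shows "measure_pmf.prob f (- ({..<d} \<rightarrow>\<^sub>E {..<m})) \<le> d * \<tau>"
proof -
  have "measure_pmf.prob f (- ({..<d} \<rightarrow>\<^sub>E {..<m})) =
      measure_pmf.prob f (- ({..<d} \<rightarrow>\<^sub>E {..<m}) \<inter> set_pmf f)"
    by (simp add: measure_Int_set_pmf)
  also have "\<dots> \<le> measure_pmf.prob f (\<Union>j<d. {y. m \<le> y j})"
    using assms(1)
    by (intro measure_pmf.finite_measure_mono) (auto simp: pmfs_def nat_vecs_def PiE_iff not_less)
  also have "\<dots> \<le> (\<Sum>j<d. measure_pmf.prob f {y. m \<le> y j})"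
    by (intro measure_pmf.finite_measure_subadditive_finite) auto
  also have "\<dots> \<le> (\<Sum>j<d. \<tau>)"
    using tail by (intro sum_mono) auto
  finally show ?thesis by simp
qed

text \<open>With coordinate tails of order \<open>1 / n\<^sup>2\<close>, the cost of leaving the box
  is of order \<open>d / n\<close>. The factor \<open>d\<close> is absorbed by
  \<open>d <= 2 ^ d <= b ^ d\<close>, which is why \<open>b\<close> is at least 2.\<close>

lemma hellinger_risk_le_of_tail:
  fixes b :: real
  assumes pos: "0 < \<kappa>\<^sub>1" "0 < \<kappa>\<^sub>2" and n: "0 < n" and d: "1 \<le> d"
    and D: "decomposition_property d D" "sandwich_property \<kappa>\<^sub>1 \<kappa>\<^sub>2 d D"
    and Ghat: "min_distance_estimator d n D Ghat"
    and G: "G \<in> borel_probs d (nonneg_vecs d)"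
    and tail: "\<And>j. j < d \<Longrightarrow> measure_pmf.prob (poisson_mixture d G) {y. m \<le> y j} \<le> 3 / (real n)\<^sup>2"
    and m: "m \<le> b" and b: "2 \<le> b"
  shows "hellinger_risk d n Ghat G \<le> ennreal (((16 * (\<kappa>\<^sub>2 / \<kappa>\<^sub>1) + 6) * b) ^ d / n)"
proof -
  let ?B = "{..<d} \<rightarrow>\<^sub>E {..<m}"
  define M where "M = \<kappa>\<^sub>2 / \<kappa>\<^sub>1"
  have M: "0 < M" using pos by (simp add: M_def)
  \<comment> \<open>The constant vector \<open>m\<close> lies outside the box because there is at
    least one coordinate.\<close>
  have "(\<lambda>j\<in>{..<d}. m) \<in> nat_vecs d - ?B"
    using d by (simp add: nat_vecs_def PiE_iff) (rule exI[of _ 0], simp)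
  moreover have "?B \<subseteq> nat_vecs d"
    unfolding nat_vecs_def by (intro PiE_mono) auto
  ultimately have B: "finite ?B" "?B \<subset> nat_vecs d"
    by (simp add: finite_PiE, blast)
  have card: "card ?B = m ^ d"
    by (simp add: card_PiE)
  have "hellinger_risk d n Ghat G \<le>
      ennreal (4 * M * (card ?B / n + d * (3 / (real n)\<^sup>2)) + 2 * (n * (d * (3 / (real n)\<^sup>2))))"
    unfolding M_def using pos n D Ghat G B
    by (rule hellinger_risk_le)
       (use prob_outside_box_le[OF poisson_mixture_in_pmfs[OF G] tail] in simp)
  also have "\<dots> \<le> ennreal (((16 * M + 6) * b) ^ d / n)"
  proof (rule ennreal_leI)
    have "real d \<le> 2 ^ d"
      using less_exp[of d] by (metis of_nat_less_iff of_nat_power of_nat_numeral less_imp_le)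
    also have "\<dots> \<le> b ^ d"
      using b by (intro power_mono) auto
    finally have db: "real d \<le> b ^ d" .
    have mb: "real m ^ d \<le> b ^ d"
      using m by (intro power_mono) auto
    have "3 * real d / n \<le> 3 * d"
      using n by (simp add: divide_le_eq mult_le_cancel_left1)
    then have "4 * M * (real m ^ d + 3 * d / n) + 6 * d \<le> 4 * M * (b ^ d + 3 * b ^ d) + 6 * b ^ d"
      using mb db M by (intro add_mono mult_left_mono) auto
    \<comment> \<open>The coefficient is at least 1 and \<open>1 <= d\<close>, so it may be moved
      inside the \<open>d\<close>-th power.\<close>
    also have "\<dots> = (16 * M + 6) ^ 1 * b ^ d"
      by (simp add: algebra_simps)
    also have "\<dots> \<le> (16 * M + 6) ^ d * b ^ d"
      using M d b by (intro mult_right_mono power_increasing) auto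
    finally have *: "4 * M * (real m ^ d + 3 * d / n) + 6 * d \<le> ((16 * M + 6) * b) ^ d"
      by (simp add: power_mult_distrib)
    have "4 * M * (card ?B / n + d * (3 / (real n)\<^sup>2)) + 2 * (n * (d * (3 / (real n)\<^sup>2))) =
        (4 * M * (real m ^ d + 3 * d / n) + 6 * d) / n"
      using n by (simp add: card power2_eq_square add_divide_distrib distrib_left)
    also have "\<dots> \<le> ((16 * M + 6) * b) ^ d / n"
      using * by (rule divide_right_mono) simp
    finally show "4 * M * (card ?B / n + d * (3 / (real n)\<^sup>2)) + 2 * (n * (d * (3 / (real n)\<^sup>2))) \<le>
      ((16 * M + 6) * b) ^ d / n" .
  qed
  finally show ?thesis
    by (simp only: M_def)
qed

text \<open>The tilt is \<open>x = exp u\<close> and the box side is \<open>b\<close> rounded up.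
  The condition on \<open>u\<close> says that the Chernoff exponent
  \<open>t * (exp u - 1) - b * u\<close> is at most \<open>- 2 * ln n\<close>.\<close>

lemma hellinger_risk_le_of_chernoff:
  assumes pos: "0 < \<kappa>\<^sub>1" "0 < \<kappa>\<^sub>2" and n: "0 < n" and d: "1 \<le> d"
    and D: "decomposition_property d D" "sandwich_property \<kappa>\<^sub>1 \<kappa>\<^sub>2 d D"
    and Ghat: "min_distance_estimator d n D Ghat"
    and G: "G \<in> borel_probs d (nonneg_vecs d)"
    and tail: "\<And>j. j < d \<Longrightarrow> measure G {\<theta> \<in> space G. t < \<theta> j} \<le> 2 / (real n)\<^sup>2"
    and u: "0 \<le> u" "t * (exp u - 1) + 2 * ln n \<le> b * u" and b: "1 \<le> b"
  shows "hellinger_risk d n Ghat G \<le> ennreal (((16 * (\<kappa>\<^sub>2 / \<kappa>\<^sub>1) + 6) * (2 * b)) ^ d / n)"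
proof -
  let ?m = "nat \<lceil>b\<rceil>"
  have "b \<le> ?m" by linarith
  \<comment> \<open>Rounding up costs at most a factor 2 because \<open>1 <= b\<close>.\<close>
  have m: "?m \<le> 2 * b" "2 \<le> 2 * b" using b by linarith+
  have "exp (t * (exp u - 1)) / exp u ^ ?m = exp (t * (exp u - 1) - ?m * u)"
    by (simp add: exp_diff exp_of_nat_mult)
  also have "\<dots> \<le> exp (- (2 * ln n))"
    using u mult_right_mono[OF \<open>b \<le> ?m\<close> u(1)] by simp
  also have "\<dots> = 1 / (real n)\<^sup>2"
    using n by (simp add: exp_minus exp_double inverse_eq_divide power_divide)
  finally have "exp (t * (exp u - 1)) / exp u ^ ?m \<le> 1 / (real n)\<^sup>2" .
  \<comment> \<open>Here 3 = 2 + 1: the prior tail, with the 2 from \<open>SubE\<close>, plus the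
    Chernoff term.\<close>
  then have "measure_pmf.prob (poisson_mixture d G) {y. ?m \<le> y j} \<le> 3 / (real n)\<^sup>2" if "j < d" for j
    using prob_poisson_mixture_tail_le[OF G that, of "exp u" ?m t] tail[OF that] u(1) by simp
  from hellinger_risk_le_of_tail[OF pos n d D Ghat G this m] show ?thesis .
qed

section \<open>Priors on a cube and priors with sub-exponential marginals\<close>

text \<open>A prior on the cube lives on the smaller restricted sigma-algebra. Its push-forward
  along the inclusion has the same mixture, hence the same risk, and fits the lemmas on
  \<open>nonneg_vecs d\<close>.\<close>

lemma borel_probs_cube_extend:
  assumes "G \<in> borel_probs d (cube d h)"
  obtains G' where "G' \<in> borel_probs d (nonneg_vecs d)" "poisson_mixture d G' = poisson_mixture d G"
    "\<And>j. j < d \<Longrightarrow> measure G' {\<theta> \<in> space G'. h < \<theta> j} = 0"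
proof -
  let ?M = "(\<Pi>\<^sub>M j\<in>{..<d}. borel) :: (nat \<Rightarrow> real) measure"
  let ?N = "restrict_space ?M (nonneg_vecs d)"
  define G' where "G' = distr G ?N (\<lambda>\<theta>. \<theta>)"
  interpret prob_space G using assms by (simp add: borel_probs_def)
  have sets: "sets G = sets (restrict_space ?M (cube d h))"
    using assms by (simp add: borel_probs_def)
  have space: "space G \<subseteq> cube d h"
    using assms by (rule space_borel_probs)
  have sub: "cube d h \<subseteq> nonneg_vecs d"
    unfolding cube_def nonneg_vecs_def by (intro PiE_mono) auto
  have "(\<lambda>\<theta>. \<theta>) \<in> restrict_space ?M (cube d h) \<rightarrow>\<^sub>M ?M"
    by (intro measurable_restrict_space1 measurable_ident_sets refl)
  then have "(\<lambda>\<theta>. \<theta>) \<in> G \<rightarrow>\<^sub>M ?M"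
    using measurable_cong_sets[OF sets refl] by blast
  then have meas: "(\<lambda>\<theta>. \<theta>) \<in> G \<rightarrow>\<^sub>M ?N"
    using space sub by (intro measurable_restrict_space2) blast+
  have sets': "sets G' = sets ?N"
    by (simp add: G'_def)
  have G': "G' \<in> borel_probs d (nonneg_vecs d)"
    using prob_space_distr[OF meas] sets' unfolding borel_probs_def G'_def by blast
  moreover have "poisson_mixture d G' = poisson_mixture d G"
  proof -
    have "(\<lambda>\<theta>. poisson_mass d \<theta> y) \<in> borel_measurable ?N" for y
      using poisson_mass_measurable[OF G', of y] measurable_cong_sets[OF sets' refl] by blast
    then have "(\<integral>\<theta>. poisson_mass d \<theta> y \<partial>G') = (\<integral>\<theta>. poisson_mass d \<theta> y \<partial>G)" for y
      unfolding G'_def by (rule integral_distr[OF meas])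
    then show ?thesis
      unfolding poisson_mixture_def by (intro arg_cong[where f = embed_pmf] ext) simp
  qed
  moreover have "measure G' {\<theta> \<in> space G'. h < \<theta> j} = 0" if "j < d" for j
  proof -
    let ?A = "{\<theta> \<in> space G'. h < \<theta> j}"
    note [measurable] = measurable_component_borel_probs[OF G' that]
    have "?A \<in> sets G'"
      by measurable
    then have "measure G' ?A = measure G ((\<lambda>\<theta>. \<theta>) -` ?A \<inter> space G)"
      unfolding sets' unfolding G'_def by (rule measure_distr[OF meas])
    also have "(\<lambda>\<theta>. \<theta>) -` ?A \<inter> space G = {}"
    proof -
      have "\<theta> j \<le> h" if "\<theta> \<in> space G" for \<theta>
        using subsetD[OF space that] \<open>j < d\<close> by (simp add: cube_def PiE_iff)
      then show ?thesis
        by fastforce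
    qed
    finally show ?thesis by simp
  qed
  ultimately show ?thesis by (rule that)
qed

lemma measure_SubE_marginal_tail:
  assumes G: "G \<in> borel_probs d (nonneg_vecs d)" and j: "j < d"
    and SubE: "marginal j G \<in> SubE s" and t: "0 < t"
  shows "measure G {\<theta> \<in> space G. t < \<theta> j} \<le> 2 * exp (- t / s)"
proof -
  interpret prob_space G using G by (simp add: borel_probs_def)
  let ?R = "restrict_space borel {0..} :: real measure"
  note [measurable] = measurable_component_borel_probs[OF G j]
  have meas: "(\<lambda>\<theta>. \<theta> j) \<in> G \<rightarrow>\<^sub>M ?R"
    using space_borel_probs[OF G] j
    by (intro measurable_restrict_space2) (measurable, auto simp: nonneg_vecs_def PiE_iff)
  have "measure G {\<theta> \<in> space G. t < \<theta> j} \<le> measure G ((\<lambda>\<theta>. \<theta> j) -` {t..} \<inter> space G)"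
    by (intro finite_measure_mono) auto
  also have "\<dots> = measure (marginal j G) {t..}"
  proof -
    have "{t..} \<in> sets ?R"
      using t by (subst sets_restrict_space_iff) auto
    then show ?thesis
      unfolding marginal_def using meas by (simp add: measure_distr)
  qed
  also have "\<dots> \<le> 2 * exp (- t / s)"
    using SubE t by (simp add: SubE_def)
  finally show ?thesis .
qed

section \<open>Choice of the tilt and the two rates\<close>

theorem theorem5:
  fixes \<kappa>\<^sub>1 \<kappa>\<^sub>2 :: real
  assumes "\<kappa>\<^sub>1 > 0" and "\<kappa>\<^sub>2 > 0"
  shows "\<exists>c\<^sub>1>0. \<exists>c\<^sub>2>0. \<forall>(d::nat)\<ge>1. \<forall>D.
    generalized_distance d D \<and> decomposition_property d D \<and>
    sandwich_property \<kappa>\<^sub>1 \<kappa>\<^sub>2 d D \<longrightarrow>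
    (\<forall>(n::nat)\<ge>3. \<forall>Ghat. min_distance_estimator d n D Ghat \<longrightarrow>
      (\<forall>h>0.
        (SUP G \<in> borel_probs d (cube d h). hellinger_risk d n Ghat G)
          \<le> ennreal ((c\<^sub>1 * min (max 1 h * (ln n / ln (ln n))) (h + ln n)) ^ d / n)) \<and>
      (\<forall>s>0. \<forall>\<G> \<subseteq> borel_probs d (nonneg_vecs d).
        (\<forall>G\<in>\<G>. \<forall>j<d. marginal j G \<in> SubE s) \<longrightarrow>
        (SUP G \<in> \<G>. hellinger_risk d n Ghat G)
          \<le> ennreal ((c\<^sub>2 * max 1 s) ^ d / n * ln n ^ d)))"
proof -
  define C where "C = 16 * (\<kappa>\<^sub>2 / \<kappa>\<^sub>1) + 6"
  have C: "0 < C"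
    using assms by (auto simp: C_def intro!: add_pos_pos)
  have "(SUP G \<in> borel_probs d (cube d h). hellinger_risk d n Ghat G)
        \<le> ennreal ((6 * C * min (max 1 h * (ln n / ln (ln n))) (h + ln n)) ^ d / n)" (is "?i h") and
    "(SUP G \<in> \<G>. hellinger_risk d n Ghat G) \<le> ennreal ((12 * C * max 1 s) ^ d / n * ln n ^ d)" (is ?ii)
    if "1 \<le> d" and D: "decomposition_property d D" "sandwich_property \<kappa>\<^sub>1 \<kappa>\<^sub>2 d D"
      and "3 \<le> n" and Ghat: "min_distance_estimator d n D Ghat"
      and h: "0 < h" and s: "0 < s" and \<G>: "\<G> \<subseteq> borel_probs d (nonneg_vecs d)"
      and SubE: "\<forall>G\<in>\<G>. \<forall>j<d. marginal j G \<in> SubE s"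
    for d D n Ghat h s \<G>
  proof -
    have n: "0 < n" using \<open>3 \<le> n\<close> by simp
    define L where "L = ln n"
    \<comment> \<open>Here \<open>3 <= n\<close> enters: \<open>ln n > 1\<close>, so
      \<open>ln (ln n)\<close> is positive.\<close>
    have "exp 1 < real n"
      using e_less_272 \<open>3 \<le> n\<close> by linarith
    then have "ln (exp 1) < L"
      unfolding L_def using n by (subst ln_less_cancel_iff) auto
    then have L: "1 < L" by simp
    have e: "exp 1 \<le> (3::real)"
      by (rule exp_le)
    note risk_le = hellinger_risk_le_of_chernoff[OF assms n \<open>1 \<le> d\<close> D Ghat, folded C_def L_def]
    let ?K\<^sub>1 = "max 1 h * (L / ln L)" and ?K\<^sub>2 = "h + L"
    have "hellinger_risk d n Ghat G \<le> ennreal ((6 * C * min ?K\<^sub>1 ?K\<^sub>2) ^ d / n)"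
      if "G \<in> borel_probs d (cube d h)" for G
    proof -
      obtain G' where G': "G' \<in> borel_probs d (nonneg_vecs d)"
        and eq: "poisson_mixture d G' = poisson_mixture d G"
        and tail: "\<And>j. j < d \<Longrightarrow> measure G' {\<theta> \<in> space G'. h < \<theta> j} = 0"
        using borel_probs_cube_extend[OF \<open>G \<in> borel_probs d (cube d h)\<close>] by blast
      have risk_eq: "hellinger_risk d n Ghat G = hellinger_risk d n Ghat G'"
        by (simp add: hellinger_risk_def eq)
      have tail': "measure G' {\<theta> \<in> space G'. h < \<theta> j} \<le> 2 / (real n)\<^sup>2" if "j < d" for j
        using tail[OF that] by simp
      have "0 < ln L" using L by simp
      have "ln L \<le> L" using ln_le_minus_one[of L] L by simp
      then have "1 \<le> L / ln L"
        using \<open>0 < ln L\<close> by simp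
      then have K1: "1 \<le> ?K\<^sub>1"
        using mult_mono[of 1 "max 1 h" 1 "L / ln L"] by simp
      show ?thesis
      proof (cases "?K\<^sub>1 \<le> ?K\<^sub>2")
        case True
        \<comment> \<open>The tilt \<open>u = ln L\<close> gives \<open>exp u = L\<close>, and
          \<open>b = 3 * ?K\<^sub>1\<close> cancels the denominator \<open>ln L\<close>. The 3
          covers \<open>h * L\<close> and \<open>2 * L\<close>.\<close>
        have "h * (exp (ln L) - 1) \<le> max 1 h * L"
          using h L by (intro mult_mono) auto
        moreover have "1 * L \<le> max 1 h * L"
          using L by (intro mult_right_mono) auto
        moreover have "3 * ?K\<^sub>1 * ln L = 3 * (max 1 h * L)"
          using \<open>0 < ln L\<close> by simp
        ultimately have "h * (exp (ln L) - 1) + 2 * L \<le> 3 * ?K\<^sub>1 * ln L"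
          by linarith
        from risk_le[OF G' tail' less_imp_le[OF \<open>0 < ln L\<close>] this]
        have "hellinger_risk d n Ghat G' \<le> ennreal ((C * (2 * (3 * ?K\<^sub>1))) ^ d / n)"
          using K1 by simp
        then show ?thesis
          using True by (simp add: risk_eq mult_ac)
      next
        case False
        \<comment> \<open>For the additive rate \<open>u = 1\<close> suffices, as
          \<open>exp 1 - 1 <= 2\<close>.\<close>
        have "h * (exp 1 - 1) \<le> h * 2"
          using h e by (intro mult_left_mono) auto
        then have "h * (exp 1 - 1) + 2 * L \<le> h * 2 + 2 * L"
          by (rule add_right_mono)
        also have "\<dots> \<le> 3 * ?K\<^sub>2 * 1"
          using h L by simp
        finally have u: "h * (exp 1 - 1) + 2 * L \<le> 3 * ?K\<^sub>2 * 1" .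
        have "1 \<le> 3 * ?K\<^sub>2"
          using h L by simp
        from risk_le[OF G' tail' zero_le_one u this]
        have "hellinger_risk d n Ghat G' \<le> ennreal ((C * (2 * (3 * ?K\<^sub>2))) ^ d / n)" .
        then show ?thesis
          using False by (simp add: risk_eq mult_ac)
      qed
    qed
    then show "?i h"
      unfolding L_def by (rule SUP_least)
    let ?m = "max 1 s"
    have "hellinger_risk d n Ghat G \<le> ennreal ((12 * C * ?m) ^ d / n * L ^ d)"
      if "G \<in> \<G>" for G
    proof -
      have G: "G \<in> borel_probs d (nonneg_vecs d)"
        using that \<G> by blast
      \<comment> \<open>This threshold makes \<open>exp (- t / s)\<close> equal to
        \<open>1 / n\<^sup>2\<close>.\<close>
      define t where "t = 2 * s * L"
      have t: "0 < t" using s L by (simp add: t_def)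
      have "exp (- t / s) = exp (- (2 * L))"
        using s by (simp add: t_def)
      also have "\<dots> = 1 / (real n)\<^sup>2"
        using n by (simp add: L_def exp_minus exp_double inverse_eq_divide power_divide)
      finally have "exp (- t / s) = 1 / (real n)\<^sup>2" .
      then have tail: "measure G {\<theta> \<in> space G. t < \<theta> j} \<le> 2 / (real n)\<^sup>2" if "j < d" for j
        using measure_SubE_marginal_tail[OF G that _ t] SubE \<open>G \<in> \<G>\<close> that by fastforce
      \<comment> \<open>Again \<open>u = 1\<close>. The prior contributes \<open>4 * s * L\<close>
        and the sample size \<open>2 * L\<close>, hence the 6; doubling by the rounding gives
        \<open>12 * C\<close>.\<close>
      have "t * (exp 1 - 1) \<le> t * 2"
        using t e by (intro mult_left_mono) auto
      then have "t * (exp 1 - 1) + 2 * L \<le> t * 2 + 2 * L"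
        by (rule add_right_mono)
      also have "\<dots> = 4 * (s * L) + 2 * (1 * L)"
        by (simp add: t_def)
      also have "\<dots> \<le> 4 * (?m * L) + 2 * (?m * L)"
        using L by (intro add_mono mult_left_mono mult_right_mono) auto
      also have "\<dots> = 6 * (?m * L) * 1"
        by simp
      finally have u: "t * (exp 1 - 1) + 2 * L \<le> 6 * (?m * L) * 1" .
      have "1 * 1 \<le> ?m * L"
        using L by (intro mult_mono) auto
      then have "1 \<le> 6 * (?m * L)"
        by linarith
      from risk_le[OF G tail zero_le_one u this]
      have "hellinger_risk d n Ghat G \<le> ennreal ((C * (2 * (6 * (?m * L)))) ^ d / n)" .
      also have "(C * (2 * (6 * (?m * L)))) ^ d / n = (12 * C * ?m) ^ d / n * L ^ d"
      proof -
        have "C * (2 * (6 * (?m * L))) = 12 * C * ?m * L"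
          by simp
        then show ?thesis
          by (simp only: power_mult_distrib times_divide_eq_left)
      qed
      finally show ?thesis .
    qed
    then show ?ii
      unfolding L_def by (rule SUP_least)
  qed
  note risk = this
  show ?thesis
  proof (rule exI[of _ "6 * C"], intro conjI exI[of _ "12 * C"] allI impI, goal_cases)
    case (3 d D n Ghat h)
    then show ?case
      \<comment> \<open>Both rates were proved under joint assumptions; those on the class of priors
        are met by \<open>s = 1\<close> and the empty class.\<close>
      using risk(1)[of d D n Ghat h 1 "{}"] by (elim conjE) simp
  next
    case (4 d D n Ghat s \<G>)
    then show ?case
      using risk(2)[of d D n Ghat 1 s \<G>] by (elim conjE) simp
  qed (use C in simp_all)
qed

end
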